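(* Let $B\subseteq\mathbb{N}$ be enumerable and $n\in\mathbb{N}$. Then the following statement is derivable in the system $\mathrm{MQC}^+_{n\in B}$ (i.e. with parameter $S:=(n\in B)$): if for every $s\in\mathbb{N}$ and every $C\subseteq B$ such that $\forall x\,(x\in C\vee(x\in C\to s\in B))$ we have that $\exists m\,(m\in C\to s\in B)$ implies $\exists m\,((m\in C\to s\in B)\wedge m\in B)$, then $n\in B$.
   Context: A $\Sigma$-formula is one built only from existential quantifiers over $\mathbb{N}$, disjunction, conjunction and equality of natural numbers; $B\subseteq\mathbb{N}$ is enumerable if membership $x\in B$ is given by a $\Sigma$-formula, so $n\in B$ is a closed $\Sigma$-formula. $\mathrm{MQC}^+_S$, parameterized by a closed $\Sigma$-formula $S$, is the following natural deduction system. Judgements are sequents $\Gamma\vdash A$ (unmarked) or $\Gamma\vdash_S A$ (marked). All usual rules of minimal intuitionistic predicate logic (axiom, introduction and elimination for $\wedge,\vee,\to,\forall,\exists$; no ex falso rule) are allowed in both forms, with the same marker in all premises and conclusion. Two additional rules: reset: from $\Gamma\vdash_S S$ infer $\Gamma\vdash S$ (or $\Gamma\vdash_S S$); shift: from $\Gamma, A\to S\vdash_S S$ infer $\Gamma\vdash_S A$, for any formula $A$. Derivability means derivability of an unmarked sequent with empty context. *)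

theory Defs
  imports Main
begin

text \<open>
  Syntax, with de Bruijn indices. There are two sorts of variables: numbers and
  sets of numbers, indexed independently; \<open>All\<close>, \<open>Ex\<close> bind number variables and
  \<open>SAll\<close>, \<open>SEx\<close> bind set variables. The sort of sets is what lets a formula
  quantify over the subsets of the natural numbers. Terms are those of
  arithmetic, extended by an arbitrary type \<open>'f\<close> of further function symbols.
\<close>

datatype 'f trm =
    Var nat
  | Zero
  | Succ "'f trm"
  | Add "'f trm" "'f trm"
  | Mult "'f trm" "'f trm"
  | Fun 'f "'f trm list"

datatype 'f form =
    Eq "'f trm" "'f trm"             (infix \<open>\<^bold>=\<close> 60)
  | Mem "'f trm" nat                 (infix \<open>\<^bold>\<in>\<close> 60)
  | Conj "'f form" "'f form"         (infixr \<open>\<^bold>\<and>\<close> 55)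
  | Disj "'f form" "'f form"         (infixr \<open>\<^bold>\<or>\<close> 54)
  | Imp "'f form" "'f form"          (infixr \<open>\<^bold>\<longrightarrow>\<close> 53)
  | All "'f form"
  | Ex "'f form"
  | SAll "'f form"
  | SEx "'f form"

primrec num :: "nat \<Rightarrow> 'f trm" where
  "num 0 = Zero"
| "num (Suc n) = Succ (num n)"


primrec subst_trm :: "(nat \<Rightarrow> 'f trm) \<Rightarrow> 'f trm \<Rightarrow> 'f trm" where
  "subst_trm \<sigma> (Var i) = \<sigma> i"
| "subst_trm \<sigma> Zero = Zero"
| "subst_trm \<sigma> (Succ t) = Succ (subst_trm \<sigma> t)"
| "subst_trm \<sigma> (Add t u) = Add (subst_trm \<sigma> t) (subst_trm \<sigma> u)"
| "subst_trm \<sigma> (Mult t u) = Mult (subst_trm \<sigma> t) (subst_trm \<sigma> u)"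
| "subst_trm \<sigma> (Fun f ts) = Fun f (map (subst_trm \<sigma>) ts)"

definition up :: "(nat \<Rightarrow> 'f trm) \<Rightarrow> nat \<Rightarrow> 'f trm" where
  "up \<sigma> = case_nat (Var 0) (\<lambda>i. subst_trm (\<lambda>j. Var (Suc j)) (\<sigma> i))"

primrec subst :: "(nat \<Rightarrow> 'f trm) \<Rightarrow> 'f form \<Rightarrow> 'f form" where
  "subst \<sigma> (t \<^bold>= u) = (subst_trm \<sigma> t \<^bold>= subst_trm \<sigma> u)"
| "subst \<sigma> (t \<^bold>\<in> X) = (subst_trm \<sigma> t \<^bold>\<in> X)"
| "subst \<sigma> (A \<^bold>\<and> B) = (subst \<sigma> A \<^bold>\<and> subst \<sigma> B)"
| "subst \<sigma> (A \<^bold>\<or> B) = (subst \<sigma> A \<^bold>\<or> subst \<sigma> B)"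
| "subst \<sigma> (A \<^bold>\<longrightarrow> B) = (subst \<sigma> A \<^bold>\<longrightarrow> subst \<sigma> B)"
| "subst \<sigma> (All A) = All (subst (up \<sigma>) A)"
| "subst \<sigma> (Ex A) = Ex (subst (up \<sigma>) A)"
| "subst \<sigma> (SAll A) = SAll (subst \<sigma> A)"
| "subst \<sigma> (SEx A) = SEx (subst \<sigma> A)"

definition lift :: "'f form \<Rightarrow> 'f form" where
  "lift A = subst (\<lambda>i. Var (Suc i)) A"

definition inst :: "'f form \<Rightarrow> 'f trm \<Rightarrow> 'f form" where
  "inst A t = subst (case_nat t Var) A"


primrec srename :: "(nat \<Rightarrow> nat) \<Rightarrow> 'f form \<Rightarrow> 'f form" where
  "srename \<rho> (t \<^bold>= u) = (t \<^bold>= u)"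
| "srename \<rho> (t \<^bold>\<in> X) = (t \<^bold>\<in> \<rho> X)"
| "srename \<rho> (A \<^bold>\<and> B) = (srename \<rho> A \<^bold>\<and> srename \<rho> B)"
| "srename \<rho> (A \<^bold>\<or> B) = (srename \<rho> A \<^bold>\<or> srename \<rho> B)"
| "srename \<rho> (A \<^bold>\<longrightarrow> B) = (srename \<rho> A \<^bold>\<longrightarrow> srename \<rho> B)"
| "srename \<rho> (All A) = All (srename \<rho> A)"
| "srename \<rho> (Ex A) = Ex (srename \<rho> A)"
| "srename \<rho> (SAll A) = SAll (srename (case_nat 0 (\<lambda>i. Suc (\<rho> i))) A)"
| "srename \<rho> (SEx A) = SEx (srename (case_nat 0 (\<lambda>i. Suc (\<rho> i))) A)"

definition slift :: "'f form \<Rightarrow> 'f form" where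
  "slift A = srename Suc A"

text \<open>
  Set variables are replaced by abstracts \<open>{x. P}\<close>. Such an abstract is
  represented by the formula \<open>P\<close> in which number variable \<open>0\<close> is the bound \<open>x\<close>
  and number variable \<open>Suc j\<close> stands for the variable \<open>j\<close> of the context.
\<close>

primrec ssubst :: "(nat \<Rightarrow> 'f form) \<Rightarrow> 'f form \<Rightarrow> 'f form" where
  "ssubst \<sigma> (t \<^bold>= u) = (t \<^bold>= u)"
| "ssubst \<sigma> (t \<^bold>\<in> X) = inst (\<sigma> X) t"
| "ssubst \<sigma> (A \<^bold>\<and> B) = (ssubst \<sigma> A \<^bold>\<and> ssubst \<sigma> B)"
| "ssubst \<sigma> (A \<^bold>\<or> B) = (ssubst \<sigma> A \<^bold>\<or> ssubst \<sigma> B)"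
| "ssubst \<sigma> (A \<^bold>\<longrightarrow> B) = (ssubst \<sigma> A \<^bold>\<longrightarrow> ssubst \<sigma> B)"
| "ssubst \<sigma> (All A) = All (ssubst (\<lambda>X. subst (up (\<lambda>i. Var (Suc i))) (\<sigma> X)) A)"
| "ssubst \<sigma> (Ex A) = Ex (ssubst (\<lambda>X. subst (up (\<lambda>i. Var (Suc i))) (\<sigma> X)) A)"
| "ssubst \<sigma> (SAll A) = SAll (ssubst (case_nat (Var 0 \<^bold>\<in> 0) (\<lambda>X. slift (\<sigma> X))) A)"
| "ssubst \<sigma> (SEx A) = SEx (ssubst (case_nat (Var 0 \<^bold>\<in> 0) (\<lambda>X. slift (\<sigma> X))) A)"

definition sinst :: "'f form \<Rightarrow> 'f form \<Rightarrow> 'f form" where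
  "sinst A P = ssubst (case_nat P (\<lambda>X. Var 0 \<^bold>\<in> X)) A"


primrec first_order :: "'f form \<Rightarrow> bool" where
  "first_order (t \<^bold>= u) = True"
| "first_order (t \<^bold>\<in> X) = True"
| "first_order (A \<^bold>\<and> B) = (first_order A \<and> first_order B)"
| "first_order (A \<^bold>\<or> B) = (first_order A \<and> first_order B)"
| "first_order (A \<^bold>\<longrightarrow> B) = (first_order A \<and> first_order B)"
| "first_order (All A) = first_order A"
| "first_order (Ex A) = first_order A"
| "first_order (SAll A) = False"
| "first_order (SEx A) = False"

inductive Sigma_form :: "'f form \<Rightarrow> bool" where
  "Sigma_form (t \<^bold>= u)"
| "Sigma_form A \<Longrightarrow> Sigma_form B \<Longrightarrow> Sigma_form (A \<^bold>\<and> B)"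
| "Sigma_form A \<Longrightarrow> Sigma_form B \<Longrightarrow> Sigma_form (A \<^bold>\<or> B)"
| "Sigma_form A \<Longrightarrow> Sigma_form (Ex A)"

primrec bounded_trm :: "nat \<Rightarrow> 'f trm \<Rightarrow> bool" where
  "bounded_trm k (Var i) = (i < k)"
| "bounded_trm k Zero = True"
| "bounded_trm k (Succ t) = bounded_trm k t"
| "bounded_trm k (Add t u) = (bounded_trm k t \<and> bounded_trm k u)"
| "bounded_trm k (Mult t u) = (bounded_trm k t \<and> bounded_trm k u)"
| "bounded_trm k (Fun f ts) = list_all (bounded_trm k) ts"

text \<open>
  \<open>bounded k j A\<close>: the free number variables of \<open>A\<close> are among \<open>0, \<dots>, k - 1\<close>
  and its free set variables among \<open>0, \<dots>, j - 1\<close>.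
\<close>

primrec bounded :: "nat \<Rightarrow> nat \<Rightarrow> 'f form \<Rightarrow> bool" where
  "bounded k j (t \<^bold>= u) = (bounded_trm k t \<and> bounded_trm k u)"
| "bounded k j (t \<^bold>\<in> X) = (bounded_trm k t \<and> X < j)"
| "bounded k j (A \<^bold>\<and> B) = (bounded k j A \<and> bounded k j B)"
| "bounded k j (A \<^bold>\<or> B) = (bounded k j A \<and> bounded k j B)"
| "bounded k j (A \<^bold>\<longrightarrow> B) = (bounded k j A \<and> bounded k j B)"
| "bounded k j (All A) = bounded (Suc k) j A"
| "bounded k j (Ex A) = bounded (Suc k) j A"
| "bounded k j (SAll A) = bounded k (Suc j) A"
| "bounded k j (SEx A) = bounded k (Suc j) A"

text \<open>
  An enumerable set is given by the \<open>\<Sigma>\<close>-formula \<open>B\<close> expressing membership in it,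
  with number variable \<open>0\<close> as its only free variable; \<open>t \<in> B\<close> is \<open>inst B t\<close>.
\<close>

definition enumerable :: "'f form \<Rightarrow> bool" where
  "enumerable B \<longleftrightarrow> Sigma_form B \<and> bounded 1 0 B"


text \<open>
  The system \<open>MQC\<^sup>+\<^sub>S\<close>, where the parameter \<open>S\<close> is meant to be a closed
  \<open>\<Sigma>\<close>-formula. In \<open>deriv S \<mu> \<Gamma> A\<close> the marker \<open>\<mu>\<close> distinguishes marked from
  unmarked sequents. Lifting the context in \<open>AllI\<close>, \<open>ExE\<close>, \<open>SAllI\<close>, \<open>SExE\<close> is
  the eigenvariable condition. The set quantifiers are instantiated by abstracts
  of formulas without set quantifiers, so no impredicative comprehension is available.
\<close>

datatype marker = Unmarked | Marked

inductive deriv :: "'f form \<Rightarrow> marker \<Rightarrow> 'f form list \<Rightarrow> 'f form \<Rightarrow> bool"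
  for S :: "'f form" where
  Ax:    "A \<in> set \<Gamma> \<Longrightarrow> deriv S \<mu> \<Gamma> A"
| ConjI: "deriv S \<mu> \<Gamma> A \<Longrightarrow> deriv S \<mu> \<Gamma> B \<Longrightarrow> deriv S \<mu> \<Gamma> (A \<^bold>\<and> B)"
| ConjE1: "deriv S \<mu> \<Gamma> (A \<^bold>\<and> B) \<Longrightarrow> deriv S \<mu> \<Gamma> A"
| ConjE2: "deriv S \<mu> \<Gamma> (A \<^bold>\<and> B) \<Longrightarrow> deriv S \<mu> \<Gamma> B"
| DisjI1: "deriv S \<mu> \<Gamma> A \<Longrightarrow> deriv S \<mu> \<Gamma> (A \<^bold>\<or> B)"
| DisjI2: "deriv S \<mu> \<Gamma> B \<Longrightarrow> deriv S \<mu> \<Gamma> (A \<^bold>\<or> B)"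
| DisjE: "deriv S \<mu> \<Gamma> (A \<^bold>\<or> B) \<Longrightarrow> deriv S \<mu> (A # \<Gamma>) C \<Longrightarrow> deriv S \<mu> (B # \<Gamma>) C
            \<Longrightarrow> deriv S \<mu> \<Gamma> C"
| ImpI:  "deriv S \<mu> (A # \<Gamma>) B \<Longrightarrow> deriv S \<mu> \<Gamma> (A \<^bold>\<longrightarrow> B)"
| ImpE:  "deriv S \<mu> \<Gamma> (A \<^bold>\<longrightarrow> B) \<Longrightarrow> deriv S \<mu> \<Gamma> A \<Longrightarrow> deriv S \<mu> \<Gamma> B"
| AllI:  "deriv S \<mu> (map lift \<Gamma>) A \<Longrightarrow> deriv S \<mu> \<Gamma> (All A)"
| AllE:  "deriv S \<mu> \<Gamma> (All A) \<Longrightarrow> deriv S \<mu> \<Gamma> (inst A t)"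
| ExI:   "deriv S \<mu> \<Gamma> (inst A t) \<Longrightarrow> deriv S \<mu> \<Gamma> (Ex A)"
| ExE:   "deriv S \<mu> \<Gamma> (Ex A) \<Longrightarrow> deriv S \<mu> (A # map lift \<Gamma>) (lift C) \<Longrightarrow> deriv S \<mu> \<Gamma> C"
| SAllI: "deriv S \<mu> (map slift \<Gamma>) A \<Longrightarrow> deriv S \<mu> \<Gamma> (SAll A)"
| SAllE: "deriv S \<mu> \<Gamma> (SAll A) \<Longrightarrow> first_order P \<Longrightarrow> deriv S \<mu> \<Gamma> (sinst A P)"
| SExI:  "deriv S \<mu> \<Gamma> (sinst A P) \<Longrightarrow> first_order P \<Longrightarrow> deriv S \<mu> \<Gamma> (SEx A)"
| SExE:  "deriv S \<mu> \<Gamma> (SEx A) \<Longrightarrow> deriv S \<mu> (A # map slift \<Gamma>) (slift C) \<Longrightarrow> deriv S \<mu> \<Gamma> C"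
| Reset: "deriv S Marked \<Gamma> S \<Longrightarrow> deriv S \<mu> \<Gamma> S"
| Shift: "deriv S Marked ((A \<^bold>\<longrightarrow> S) # \<Gamma>) S \<Longrightarrow> deriv S Marked \<Gamma> A"

definition derivable :: "'f form \<Rightarrow> 'f form \<Rightarrow> bool" where
  "derivable S A \<longleftrightarrow> deriv S Unmarked [] A"

end

theory Submission
  imports Defs
begin

text \<open>
  In marked sequents the parameter \<open>S\<close> behaves as a classical falsity: shift is double negation
  elimination relative to \<open>S\<close>. Hence \<open>x \<in> B \<or> (x \<in> B \<longrightarrow> S)\<close> holds for every \<open>x\<close>, and the
  hypothesis applies to \<open>s = n\<close> and \<open>C = B\<close>; its premise \<open>\<exists>m. m \<in> B \<longrightarrow> n \<in> B\<close> is witnessed by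
  \<open>m = n\<close>. The resulting \<open>m\<close> satisfies both \<open>m \<in> B \<longrightarrow> S\<close> and \<open>m \<in> B\<close>, which gives \<open>S\<close>, and
  reset removes the marker.
\<close>

lemma subst_trm_num [simp]: "subst_trm \<sigma> (num n) = num n"
  by (induction n) auto

lemma subst_trm_subst_trm: "subst_trm \<tau> (subst_trm \<sigma> t) = subst_trm (\<lambda>i. subst_trm \<tau> (\<sigma> i)) t"
  by (induction t) auto

lemma up_compose: "(\<lambda>i. subst_trm (up \<tau>) (up \<sigma> i)) = up (\<lambda>i. subst_trm \<tau> (\<sigma> i))"
  by (rule ext) (simp add: up_def subst_trm_subst_trm split: nat.split)

lemma subst_subst: "subst \<tau> (subst \<sigma> A) = subst (\<lambda>i. subst_trm \<tau> (\<sigma> i)) A"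
  by (induction A arbitrary: \<sigma> \<tau>) (simp_all add: subst_trm_subst_trm up_compose)

lemma subst_trm_cong_bounded:
  "bounded_trm k t \<Longrightarrow> (\<And>i. i < k \<Longrightarrow> \<sigma> i = \<tau> i) \<Longrightarrow> subst_trm \<sigma> t = subst_trm \<tau> t"
  by (induction t) (auto simp: list_all_iff)

lemma subst_cong_bounded:
  "bounded k j A \<Longrightarrow> (\<And>i. i < k \<Longrightarrow> \<sigma> i = \<tau> i) \<Longrightarrow> subst \<sigma> A = subst \<tau> A"
proof (induction A arbitrary: k j \<sigma> \<tau>)
  case (All A)
  have "subst (up \<sigma>) A = subst (up \<tau>) A"
    using All.prems by (intro All.IH[of "Suc k" j]) (auto simp: up_def split: nat.split)
  then show ?case by simp
next
  case (Ex A)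
  have "subst (up \<sigma>) A = subst (up \<tau>) A"
    using Ex.prems by (intro Ex.IH[of "Suc k" j]) (auto simp: up_def split: nat.split)
  then show ?case by simp
next
  case (SAll A)
  show ?case using SAll.IH[of k "Suc j" \<sigma> \<tau>] SAll.prems by simp
next
  case (SEx A)
  show ?case using SEx.IH[of k "Suc j" \<sigma> \<tau>] SEx.prems by simp
next
  case (Eq t u)
  then show ?case by (auto intro: subst_trm_cong_bounded)
next
  case (Mem t X)
  then show ?case by (auto intro: subst_trm_cong_bounded)
next
  case (Conj A B)
  show ?case using Conj.IH[of k j \<sigma> \<tau>] Conj.prems by simp
next
  case (Disj A B)
  show ?case using Disj.IH[of k j \<sigma> \<tau>] Disj.prems by simp
next
  case (Imp A B)
  show ?case using Imp.IH[of k j \<sigma> \<tau>] Imp.prems by simp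
qed

text \<open>Only variable 0 is free in \<open>A\<close>, so just the value \<open>\<sigma> 0\<close>
  matters. This brings every substituted copy of \<open>B\<close> into the normal form
  \<open>inst B t\<close>, whatever shifts \<open>up\<close> has introduced.\<close>

lemma subst_eq_inst:
  assumes "bounded 1 j A"
  shows "subst \<sigma> A = inst A (\<sigma> 0)"
  unfolding inst_def using assms by (rule subst_cong_bounded) simp

lemma subst_inst:
  assumes "bounded 1 j A"
  shows "subst \<tau> (inst A t) = inst A (subst_trm \<tau> t)"
  unfolding inst_def[of A t] subst_subst by (simp add: subst_eq_inst[OF assms])

text \<open>Nested instances arise when \<open>ssubst\<close> replaces a membership atom by an
  instance of an abstract.\<close>

lemma inst_inst:
  assumes "bounded 1 j A"
  shows "inst (inst A t) u = inst A (subst_trm (case_nat u Var) t)"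
  unfolding inst_def[of "inst A t"] by (rule subst_inst[OF assms])

lemma Sigma_form_subst: "Sigma_form A \<Longrightarrow> Sigma_form (subst \<sigma> A)"
  by (induction arbitrary: \<sigma> rule: Sigma_form.induct) (auto intro: Sigma_form.intros)

lemma Sigma_form_inst: "Sigma_form A \<Longrightarrow> Sigma_form (inst A t)"
  by (simp add: inst_def Sigma_form_subst)

text \<open>A \<Sigma>-formula has no membership atoms to replace and no set quantifiers.\<close>

lemma ssubst_Sigma_form: "Sigma_form A \<Longrightarrow> ssubst \<sigma> A = A"
  by (induction arbitrary: \<sigma> rule: Sigma_form.induct) auto

lemma Sigma_form_first_order: "Sigma_form A \<Longrightarrow> first_order A"
  by (induction rule: Sigma_form.induct) auto

text \<open>The usual intuitionistic refutation of the negated excluded middle, with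
  \<open>S\<close> as falsity; shift then removes the double negation.\<close>

lemma deriv_excluded_middle: "deriv S Marked \<Gamma> (A \<^bold>\<or> (A \<^bold>\<longrightarrow> S))"
proof (rule Shift, rule ImpE)
  let ?\<Delta> = "((A \<^bold>\<or> (A \<^bold>\<longrightarrow> S)) \<^bold>\<longrightarrow> S) # \<Gamma>"
  show "deriv S Marked ?\<Delta> ((A \<^bold>\<or> (A \<^bold>\<longrightarrow> S)) \<^bold>\<longrightarrow> S)"
    by (rule Ax) simp
  have "deriv S Marked (A # ?\<Delta>) S"
  proof (rule ImpE)
    show "deriv S Marked (A # ?\<Delta>) ((A \<^bold>\<or> (A \<^bold>\<longrightarrow> S)) \<^bold>\<longrightarrow> S)"
      by (rule Ax) simp
    show "deriv S Marked (A # ?\<Delta>) (A \<^bold>\<or> (A \<^bold>\<longrightarrow> S))"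
      by (rule DisjI1[OF Ax]) simp
  qed
  then show "deriv S Marked ?\<Delta> (A \<^bold>\<or> (A \<^bold>\<longrightarrow> S))"
    by (rule DisjI2[OF ImpI])
qed

(* Number variables in the formula: s is 0 below its quantifier and 1 below a further
   number quantifier, whose variable (x or m) is then 0. The set variable C is 0. *)
theorem theorem4:
  fixes B :: "'f form" and n :: nat
  assumes "enumerable B"
  shows "derivable (inst B (num n))
    (All (SAll
       (All (Var 0 \<^bold>\<in> 0 \<^bold>\<longrightarrow> inst B (Var 0))
        \<^bold>\<longrightarrow> All (Var 0 \<^bold>\<in> 0 \<^bold>\<or> (Var 0 \<^bold>\<in> 0 \<^bold>\<longrightarrow> inst B (Var 1)))
        \<^bold>\<longrightarrow> Ex (Var 0 \<^bold>\<in> 0 \<^bold>\<longrightarrow> inst B (Var 1))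
        \<^bold>\<longrightarrow> Ex ((Var 0 \<^bold>\<in> 0 \<^bold>\<longrightarrow> inst B (Var 1)) \<^bold>\<and> inst B (Var 0))))
     \<^bold>\<longrightarrow> inst B (num n))"
proof -
  have bd: "bounded 1 0 B" and sg: "Sigma_form B"
    using assms by (auto simp: enumerable_def)
  let ?S = "inst B (num n)" and ?B = "inst B (Var 0)"
  let ?M = "All (Var 0 \<^bold>\<in> 0 \<^bold>\<longrightarrow> ?B)
        \<^bold>\<longrightarrow> All (Var 0 \<^bold>\<in> 0 \<^bold>\<or> (Var 0 \<^bold>\<in> 0 \<^bold>\<longrightarrow> inst B (Var 1)))
        \<^bold>\<longrightarrow> Ex (Var 0 \<^bold>\<in> 0 \<^bold>\<longrightarrow> inst B (Var 1))
        \<^bold>\<longrightarrow> Ex ((Var 0 \<^bold>\<in> 0 \<^bold>\<longrightarrow> inst B (Var 1)) \<^bold>\<and> ?B)"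
  let ?\<Gamma> = "[All (SAll ?M)]"
  let ?d = "deriv ?S Marked ?\<Gamma>"
  \<comment> \<open>The body after \<open>s := n\<close>; a set quantifier does not shift number
    variables, so the substitution passes under \<open>SAll\<close> unchanged.\<close>
  define N where "N = subst (case_nat (num n) Var) ?M"
  have "?d (inst (SAll ?M) (num n))"
    by (rule AllE[OF Ax]) simp
  then have "?d (SAll N)"
    by (simp add: inst_def[of "SAll _"] N_def)
  \<comment> \<open>The abstract for \<open>C = B\<close> is \<open>B\<close> itself, whose variable
    0 is the bound one.\<close>
  then have "?d (sinst N B)"
    using Sigma_form_first_order[OF sg] by (rule SAllE)
  moreover have "sinst N B =
      (All (?B \<^bold>\<longrightarrow> ?B) \<^bold>\<longrightarrow> All (?B \<^bold>\<or> (?B \<^bold>\<longrightarrow> ?S)) \<^bold>\<longrightarrow> Ex (?B \<^bold>\<longrightarrow> ?S) \<^bold>\<longrightarrow> Ex ((?B \<^bold>\<longrightarrow> ?S) \<^bold>\<and> ?B))"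
    by (simp add: N_def sinst_def subst_inst[OF bd] subst_eq_inst[OF bd] inst_inst[OF bd]
        ssubst_Sigma_form Sigma_form_inst sg up_def)
  ultimately have main: "?d (All (?B \<^bold>\<longrightarrow> ?B) \<^bold>\<longrightarrow> All (?B \<^bold>\<or> (?B \<^bold>\<longrightarrow> ?S)) \<^bold>\<longrightarrow> Ex (?B \<^bold>\<longrightarrow> ?S)
      \<^bold>\<longrightarrow> Ex ((?B \<^bold>\<longrightarrow> ?S) \<^bold>\<and> ?B))"
    by simp
  have sub: "?d (All (?B \<^bold>\<longrightarrow> ?B))"
    by (rule AllI[OF ImpI[OF Ax]]) simp
  \<comment> \<open>\<open>AllI\<close> lifts the context, but excluded middle holds in any marked
    context.\<close>
  have dec: "?d (All (?B \<^bold>\<or> (?B \<^bold>\<longrightarrow> ?S)))"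
    by (rule AllI[OF deriv_excluded_middle])
  have wit: "?d (Ex (?B \<^bold>\<longrightarrow> ?S))"
  proof (rule ExI)
    have "inst (?B \<^bold>\<longrightarrow> ?S) (num n) = (?S \<^bold>\<longrightarrow> ?S)"
      by (simp add: inst_def[of "_ \<^bold>\<longrightarrow> _"] subst_inst[OF bd])
    moreover have "?d (?S \<^bold>\<longrightarrow> ?S)"
      by (rule ImpI[OF Ax]) simp
    ultimately show "?d (inst (?B \<^bold>\<longrightarrow> ?S) (num n))"
      by simp
  qed
  have ex: "?d (Ex ((?B \<^bold>\<longrightarrow> ?S) \<^bold>\<and> ?B))"
    by (rule ImpE[OF ImpE[OF ImpE[OF main sub] dec] wit])
  let ?E = "(?B \<^bold>\<longrightarrow> ?S) \<^bold>\<and> ?B"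
  have E: "deriv ?S Marked (?E # map lift ?\<Gamma>) ?E"
    by (rule Ax) simp
  have "deriv ?S Marked (?E # map lift ?\<Gamma>) ?S"
    by (rule ImpE[OF ConjE1[OF E] ConjE2[OF E]])
  \<comment> \<open>Numerals are closed, so \<open>?S\<close> meets the eigenvariable condition of
    \<open>ExE\<close>.\<close>
  moreover have "lift ?S = ?S"
    by (simp add: lift_def subst_inst[OF bd])
  ultimately have "deriv ?S Marked (?E # map lift ?\<Gamma>) (lift ?S)"
    by simp
  with ex have "?d ?S"
    by (rule ExE)
  \<comment> \<open>After \<open>ImpI\<close> the unmarked goal is exactly the parameter, the only
    formula to which reset applies.\<close>
  then show ?thesis
    unfolding derivable_def by (rule ImpI[OF Reset])
qed

end
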